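(* There exists a polynomial $p\in\mathbb{C}[z_1,z_2]$ such that $\|p\|_{\mathrm{Mult}(H^2_2),3}>\|p\|_\infty$. In particular, there exists a pair $T=(T_1,T_2)$ of commuting $3\times3$ complex matrices that is a row contraction such that $\|p(T)\|>\|p\|_\infty$. Consequently, $C_{d,n}>1$ for all $d\ge2$ and $n\ge3$.
   Context: $\mathbb{B}_d$ is the open Euclidean unit ball of $\mathbb{C}^d$ and $\|p\|_\infty=\sup_{z\in\mathbb{B}_d}|p(z)|$ for $p\in\mathbb{C}[z_1,\ldots,z_d]$. A tuple $T=(T_1,\ldots,T_d)$ of matrices is a row contraction if $\|\sum_i T_iT_i^*\|^{1/2}\le1$. $H^2_d$ is the reproducing kernel Hilbert space on $\mathbb{B}_d$ with kernel $\frac{1}{1-\langle z,w\rangle}$. For $F\subset\mathbb{B}_d$, $H^2_d|_F$ is the reproducing kernel Hilbert space on $F$ whose kernel is the restriction of that kernel to $F\times F$, and $\|g\|_{\mathrm{Mult}(\mathcal{H})}$ denotes the norm of multiplication by $g$ on $\mathcal{H}$. The $n$-point multiplier norm is $\|f\|_{\mathrm{Mult}(H^2_d),n}=\sup\{\|f|_F\|_{\mathrm{Mult}(H^2_d|_F)}:F\subset\mathbb{B}_d,\ |F|\le n\}$. $C_{d,n}$ denotes the best (smallest) constant such that $\|p(T)\|\le C_{d,n}\|p\|_\infty$ for every row contraction $T$ consisting of $d$ commuting $n\times n$ matrices and every $p\in\mathbb{C}[z_1,\ldots,z_d]$. *)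

theory Defs
  imports "HOL-Analysis.Analysis" "HOL-Library.Poly_Mapping"
begin

text \<open>
  Dimensions are carried by finite index types: \<open>\<complex>\<^sup>d\<close> is \<open>complex ^ 'd\<close> and the
  \<open>n \<times> n\<close> matrices are \<open>complex ^ 'n ^ 'n\<close>, with \<open>d = CARD('d)\<close> and \<open>n = CARD('n)\<close>. The
  library norm of \<open>complex ^ 'd\<close> is the Euclidean one, so \<open>ball 0 1\<close> is the unit ball
  \<open>\<bbbB>\<^sub>d\<close>.
\<close>


subsection \<open>Polynomials\<close>

type_synonym 'd mpoly = "('d \<Rightarrow>\<^sub>0 nat) \<Rightarrow>\<^sub>0 complex"

definition eval_mpoly :: "('d::finite) mpoly \<Rightarrow> complex ^ 'd \<Rightarrow> complex" where
  "eval_mpoly p z =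
     (\<Sum>m\<in>Poly_Mapping.keys p. Poly_Mapping.lookup p m * (\<Prod>i\<in>UNIV. (z $ i) ^ Poly_Mapping.lookup m i))"

definition sup_norm :: "('d::finite) mpoly \<Rightarrow> real" where
  "sup_norm p = (SUP z\<in>ball 0 1. cmod (eval_mpoly p z))"


subsection \<open>Tuples of matrices\<close>

definition op_norm :: "complex ^ 'n ^ 'n \<Rightarrow> real" where
  "op_norm A = onorm ((*v) A)"

definition ctranspose :: "complex ^ 'n ^ 'n \<Rightarrow> complex ^ 'n ^ 'n" where
  "ctranspose A = (\<chi> i j. cnj (A $ j $ i))"

definition commuting :: "('d \<Rightarrow> complex ^ 'n ^ 'n) \<Rightarrow> bool" where
  "commuting T \<longleftrightarrow> (\<forall>i j. T i ** T j = T j ** T i)"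

definition row_contraction :: "('d::finite \<Rightarrow> complex ^ 'n ^ 'n) \<Rightarrow> bool" where
  "row_contraction T \<longleftrightarrow> sqrt (op_norm (\<Sum>i\<in>UNIV. T i ** ctranspose (T i))) \<le> 1"

text \<open>The operations \<open>*\<close> and \<open>^\<close> on type \<open>vec\<close> are componentwise, so they are not used here.\<close>

definition matpow :: "complex ^ 'n ^ 'n \<Rightarrow> nat \<Rightarrow> complex ^ 'n ^ 'n" where
  "matpow A k = (((**) A) ^^ k) (mat 1)"

text \<open>
  For a commuting tuple the order of the factors is immaterial, so that the fold below is the
  product of the powers \<open>T\<^sub>i\<^bsup>m\<^sub>i\<^esup>\<close> over all \<open>i\<close>. For other tuples it is unspecified.
\<close>

definition mat_monom :: "('d::finite \<Rightarrow>\<^sub>0 nat) \<Rightarrow> ('d \<Rightarrow> complex ^ 'n ^ 'n) \<Rightarrow> complex ^ 'n ^ 'n" where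
  "mat_monom m T =
     Finite_Set.fold (\<lambda>i M. matpow (T i) (Poly_Mapping.lookup m i) ** M) (mat 1) UNIV"

definition eval_mpoly_mat :: "('d::finite) mpoly \<Rightarrow> ('d \<Rightarrow> complex ^ 'n ^ 'n) \<Rightarrow> complex ^ 'n ^ 'n" where
  "eval_mpoly_mat p T =
     (\<Sum>m\<in>Poly_Mapping.keys p. mat (Poly_Mapping.lookup p m) ** mat_monom m T)"

text \<open>
  The smallest constant \<open>C\<^sub>d\<^sub>,\<^sub>n\<close>, as an infimum in \<open>[0, \<infinity>]\<close>. The inequality is preserved under
  infima of \<open>C\<close>, so the infimum is attained, and it is \<open>\<infinity>\<close> exactly if no finite constant works.
\<close>

definition best_const :: "'d::finite itself \<Rightarrow> 'n::finite itself \<Rightarrow> ennreal" where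
  "best_const _ _ = Inf {C. \<forall>(T :: 'd \<Rightarrow> complex ^ 'n ^ 'n) p.
     commuting T \<longrightarrow> row_contraction T \<longrightarrow>
     ennreal (op_norm (eval_mpoly_mat p T)) \<le> C * ennreal (sup_norm p)}"


subsection \<open>Reproducing kernel Hilbert spaces and multipliers\<close>

text \<open>
  A function on \<open>X\<close> is represented by a total function that vanishes off \<open>X\<close>. The inner product
  is linear in its first argument; its values outside of \<open>H\<close> are irrelevant.
\<close>

definition ip_norm :: "(('x \<Rightarrow> complex) \<Rightarrow> ('x \<Rightarrow> complex) \<Rightarrow> complex) \<Rightarrow> ('x \<Rightarrow> complex) \<Rightarrow> real" where
  "ip_norm ip f = sqrt (Re (ip f f))"

locale rkhs =
  fixes X :: "'x set"
    and k :: "'x \<Rightarrow> 'x \<Rightarrow> complex"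
    and H :: "('x \<Rightarrow> complex) set"
    and ip :: "('x \<Rightarrow> complex) \<Rightarrow> ('x \<Rightarrow> complex) \<Rightarrow> complex"
  assumes vanish: "f \<in> H \<Longrightarrow> x \<notin> X \<Longrightarrow> f x = 0"
    and zero_mem: "(\<lambda>x. 0) \<in> H"
    and add_mem: "f \<in> H \<Longrightarrow> g \<in> H \<Longrightarrow> (\<lambda>x. f x + g x) \<in> H"
    and scale_mem: "f \<in> H \<Longrightarrow> (\<lambda>x. c * f x) \<in> H"
    and ip_add: "f \<in> H \<Longrightarrow> g \<in> H \<Longrightarrow> h \<in> H \<Longrightarrow> ip (\<lambda>x. f x + g x) h = ip f h + ip g h"
    and ip_scale: "f \<in> H \<Longrightarrow> g \<in> H \<Longrightarrow> ip (\<lambda>x. c * f x) g = c * ip f g"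
    and ip_cnj: "f \<in> H \<Longrightarrow> g \<in> H \<Longrightarrow> ip g f = cnj (ip f g)"
    and ip_pos: "f \<in> H \<Longrightarrow> f \<noteq> (\<lambda>x. 0) \<Longrightarrow> Re (ip f f) > 0"
    and complete: "(\<And>j. s j \<in> H) \<Longrightarrow>
      (\<And>e. e > 0 \<Longrightarrow> \<exists>N. \<forall>i\<ge>N. \<forall>j\<ge>N. ip_norm ip (\<lambda>x. s i x - s j x) < e) \<Longrightarrow>
      \<exists>f\<in>H. (\<lambda>j. ip_norm ip (\<lambda>x. s j x - f x)) \<longlonglongrightarrow> 0"
    and kernel_mem: "y \<in> X \<Longrightarrow> (\<lambda>x. if x \<in> X then k x y else 0) \<in> H"
    and reproducing: "f \<in> H \<Longrightarrow> y \<in> X \<Longrightarrow> ip f (\<lambda>x. if x \<in> X then k x y else 0) = f y"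

text \<open>
  The norm of multiplication by \<open>g\<close> on the space with carrier \<open>H\<close> and inner product \<open>ip\<close>; it is
  \<open>\<infinity>\<close> if \<open>g\<close> does not multiply \<open>H\<close> into itself.
\<close>

definition mult_op_norm ::
  "('x \<Rightarrow> complex) set \<Rightarrow> (('x \<Rightarrow> complex) \<Rightarrow> ('x \<Rightarrow> complex) \<Rightarrow> complex) \<Rightarrow> ('x \<Rightarrow> complex) \<Rightarrow> ennreal"
where
  "mult_op_norm H ip g =
     (if \<forall>f\<in>H. (\<lambda>x. g x * f x) \<in> H
      then SUP f\<in>{f\<in>H. ip_norm ip f \<le> 1}. ennreal (ip_norm ip (\<lambda>x. g x * f x))
      else \<infinity>)"

text \<open>
  For a positive semidefinite kernel \<open>k\<close> on \<open>X\<close> the space below exists and is unique by the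
  Moore--Aronszajn theorem (up to the irrelevant values of the inner product), so the choice does
  not matter. Only the values of \<open>k\<close> on \<open>X \<times> X\<close> and of \<open>g\<close> on \<open>X\<close> enter; hence no explicit
  restriction to \<open>X\<close> is needed.
\<close>

definition rkhs_mult_norm :: "'x set \<Rightarrow> ('x \<Rightarrow> 'x \<Rightarrow> complex) \<Rightarrow> ('x \<Rightarrow> complex) \<Rightarrow> ennreal" where
  "rkhs_mult_norm X k g =
     (case (SOME (H, ip). rkhs X k H ip) of (H, ip) \<Rightarrow> mult_op_norm H ip g)"

text \<open>The kernel of \<open>H\<^sup>2\<^sub>d\<close>.\<close>

definition da_kernel :: "complex ^ 'd \<Rightarrow> complex ^ 'd \<Rightarrow> complex" where
  "da_kernel z w = 1 / (1 - (\<Sum>i\<in>UNIV. z $ i * cnj (w $ i)))"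

definition npoint_mult_norm :: "nat \<Rightarrow> (complex ^ 'd \<Rightarrow> complex) \<Rightarrow> ennreal" where
  "npoint_mult_norm n f =
     (SUP F\<in>{F. finite F \<and> card F \<le> n \<and> F \<subseteq> ball 0 1}. rkhs_mult_norm F da_kernel f)"

end

theory Submission
  imports Defs
begin

text \<open>
  The witness is \<open>p = z\<^sub>1\<^sup>2 + z\<^sub>2\<close>. On the unit ball \<open>\<bar>z\<^sub>1\<bar>\<^sup>2 \<le> 1 - u\<^sup>2\<close> for \<open>u = \<bar>z\<^sub>2\<bar>\<close>, so
  \<open>\<bar>p\<bar> \<le> 1 - u\<^sup>2 + u \<le> 5/4\<close>: the two monomials are large in different places and cannot both
  contribute fully to the supremum norm.

  They can do so in the Drury--Arveson space. There \<open>z\<^sub>1\<^sup>2\<close> and \<open>z\<^sub>2\<close> are orthogonal unit vectors.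
  Compressing the shift to the coinvariant space spanned by \<open>1\<close>, \<open>z\<^sub>1\<close> and a unit vector
  \<open>a z\<^sub>1\<^sup>2 + b z\<^sub>2\<close> gives a commuting row contraction, consisting of nilpotent \<open>3 \<times> 3\<close> matrices, for
  which \<open>p(T)\<close> has \<open>a + b\<close> as an entry. Any choice with \<open>a + b > 5/4\<close> will do;
  \<open>(a, b) = (4/5, 3/5)\<close> keeps all numbers rational (\<open>sup_norm_witness_poly_le\<close>,
  \<open>row_contraction_jet_tuple\<close>, \<open>op_norm_witness_poly_jet_tuple\<close>). Padding with zeros serves
  all larger \<open>d\<close> and \<open>n\<close>.

  The three-dimensional space above is a limit of spans of three kernel functions, at points of a
  parabola \<open>z\<^sub>2 = c z\<^sub>1\<^sup>2\<close> that move to the origin. It is not necessary to pass to the limit: the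
  points \<open>0\<close> and \<open>(\<plusminus>1/2, 1/4)\<close> on \<open>z\<^sub>2 = z\<^sub>1\<^sup>2\<close> suffice. The polynomial takes the values
  \<open>0, 1/2, 1/2\<close> there, and multiplication by it enlarges the squared norm of the sum of the two
  outer kernel functions by the factor \<open>60/31\<close>, which exceeds \<open>25/16\<close>
  (\<open>mult_op_norm_three_points\<close>). That the space on these points exists at all is shown by
  diagonalising its inner product (\<open>rkhs_of_finite_coordinates\<close>).
\<close>

section \<open>The polynomial\<close>

definition witness_poly :: "'d \<Rightarrow> 'd \<Rightarrow> 'd::finite mpoly" where
  "witness_poly i0 i1 =
     Poly_Mapping.single (Poly_Mapping.single i0 2) 1 + Poly_Mapping.single (Poly_Mapping.single i1 1) 1"

lemma single_two_neq_single_one: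
  "Poly_Mapping.single i0 (2::nat) \<noteq> Poly_Mapping.single i1 1"
proof
  assume "Poly_Mapping.single i0 (2::nat) = Poly_Mapping.single i1 1"
  then have "Poly_Mapping.lookup (Poly_Mapping.single i0 (2::nat)) i0
    = Poly_Mapping.lookup (Poly_Mapping.single i1 1) i0" by simp
  then show False by (auto simp: lookup_single when_def split: if_splits)
qed

lemma sum_keys_witness_poly:
  fixes F :: "('d::finite \<Rightarrow>\<^sub>0 nat) \<Rightarrow> complex \<Rightarrow> 'b::comm_monoid_add"
  shows "(\<Sum>m\<in>Poly_Mapping.keys (witness_poly i0 i1). F m (Poly_Mapping.lookup (witness_poly i0 i1) m))
    = F (Poly_Mapping.single i0 2) 1 + F (Poly_Mapping.single i1 1) 1"
proof -
  have l: "Poly_Mapping.lookup (witness_poly i0 i1) m =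
      (if m = Poly_Mapping.single i0 2 \<or> m = Poly_Mapping.single i1 1 then 1 else 0)" for m
    using single_two_neq_single_one[of i0 i1]
    by (auto simp: witness_poly_def lookup_add lookup_single when_def)
  have k: "Poly_Mapping.keys (witness_poly i0 i1) = {Poly_Mapping.single i0 2, Poly_Mapping.single i1 1}"
    by (auto simp: in_keys_iff l split: if_splits)
  show ?thesis
    unfolding k using single_two_neq_single_one[of i0 i1] by (simp add: l)
qed

lemma eval_witness_poly: "eval_mpoly (witness_poly i0 i1) z = (z $ i0)^2 + z $ i1"
proof -
  have prod_single: "(\<Prod>i\<in>UNIV. (z $ i) ^ Poly_Mapping.lookup (Poly_Mapping.single j n) i) = (z $ j) ^ n"
    for j n
  proof -
    have "(\<Prod>i\<in>UNIV. (z $ i) ^ Poly_Mapping.lookup (Poly_Mapping.single j n) i)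
      = (\<Prod>i\<in>UNIV. if i = j then (z $ i) ^ n else 1)"
      by (rule prod.cong) (auto simp: lookup_single when_def)
    then show ?thesis by simp
  qed
  show ?thesis
    unfolding eval_mpoly_def
    by (subst sum_keys_witness_poly[where F = "\<lambda>m c. c * (\<Prod>i\<in>UNIV. (z $ i) ^ Poly_Mapping.lookup m i)"])
       (simp add: prod_single)
qed

lemma sup_norm_witness_poly_le:
  assumes "i0 \<noteq> i1"
  shows "sup_norm (witness_poly i0 i1) \<le> 5/4"
  unfolding sup_norm_def
proof (rule cSUP_least)
  fix z :: "complex ^ 'a" assume "z \<in> ball 0 1"
  then have n: "norm z < 1" by simp
  have "(cmod (z $ i0))^2 + (cmod (z $ i1))^2 = (\<Sum>i\<in>{i0,i1}. (cmod (z $ i))^2)"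
    using assms by simp
  also have "\<dots> \<le> (\<Sum>i\<in>UNIV. (cmod (z $ i))^2)"
    by (rule sum_mono2) auto
  also have "\<dots> = (norm z)^2"
    by (simp add: norm_vec_def L2_set_def sum_nonneg)
  also have "\<dots> \<le> 1" using n by (simp add: power_le_one)
  finally have s: "(cmod (z $ i0))^2 + (cmod (z $ i1))^2 \<le> 1" .
  have "cmod (eval_mpoly (witness_poly i0 i1) z) \<le> (cmod (z $ i0))^2 + cmod (z $ i1)"
    unfolding eval_witness_poly by (metis norm_power norm_triangle_ineq)
  \<comment> \<open>This square gives \<open>1 - u\<^sup>2 + u \<le> 5/4\<close>, with equality at \<open>u = 1/2\<close>.\<close>
  moreover have "0 \<le> (cmod (z $ i1))^2 - cmod (z $ i1) + 1/4"
    using zero_le_power2[of "cmod (z $ i1) - 1/2"] by (simp add: power2_diff power_divide)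
  ultimately show "cmod (eval_mpoly (witness_poly i0 i1) z) \<le> 5/4"
    using s by linarith
qed simp


section \<open>The row contraction\<close>

definition unit_mat :: "'n \<Rightarrow> 'n \<Rightarrow> complex \<Rightarrow> complex ^ 'n ^ 'n::finite" where
  "unit_mat a b c = (\<chi> i j. if i = a \<and> j = b then c else 0)"

lemma unit_mat_mult:
  "unit_mat a b c ** unit_mat a' b' c' = (if b = a' then unit_mat a b' (c * c') else 0)"
proof -
  have "(\<Sum>k\<in>UNIV. (if i = a \<and> k = b then c else 0) * (if k = a' \<and> j = b' then c' else 0))
    = (\<Sum>k\<in>UNIV. if k = b then (if i = a \<and> b = a' \<and> j = b' then c * c' else 0) else 0)" for i j
    by (rule sum.cong) auto
  then show ?thesis
    by (auto simp: vec_eq_iff unit_mat_def matrix_matrix_mult_def)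
qed

lemma unit_mat_add: "unit_mat a b c + unit_mat a b c' = unit_mat a b (c + c')"
  by (auto simp: vec_eq_iff unit_mat_def)

lemma matrix_add_rdistrib: "(A + B) ** C = A ** C + B ** C"
  by (simp add: vec_eq_iff matrix_matrix_mult_def distrib_right sum.distrib)

lemma ctranspose_unit_mat: "ctranspose (unit_mat a b c) = unit_mat b a (cnj c)"
  by (auto simp: vec_eq_iff unit_mat_def ctranspose_def)

lemma ctranspose_add: "ctranspose (A + B) = ctranspose A + ctranspose B"
  by (simp add: vec_eq_iff ctranspose_def)

lemma ctranspose_zero: "ctranspose 0 = 0"
  by (simp add: vec_eq_iff ctranspose_def)

lemma unit_mat_mult_vec: "unit_mat a b c *v x = (\<chi> i. if i = a then c * x $ b else 0)"
proof -
  have "(\<Sum>k\<in>UNIV. (if i = a \<and> k = b then c else 0) * x $ k)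
    = (\<Sum>k\<in>UNIV. if k = b then (if i = a then c * x $ b else 0) else 0)" for i
    by (rule sum.cong) auto
  then show ?thesis
    by (auto simp: vec_eq_iff unit_mat_def matrix_vector_mult_def)
qed

lemma entry_le_op_norm: "cmod (A $ i $ j) \<le> op_norm A"
proof -
  have bl: "bounded_linear ((*v) A)"
    unfolding linear_conv_bounded_linear[symmetric]
    by (rule linearI)
       (simp_all add: vec_eq_iff matrix_vector_mult_def distrib_left sum.distrib scaleR_sum_right)
  have "cmod (A $ i $ j) = cmod ((A *v axis j 1) $ i)"
    by (simp add: matrix_vector_mult_def axis_def if_distrib cong: if_cong)
  also have "\<dots> \<le> norm (A *v axis j 1)" by (rule Finite_Cartesian_Product.norm_nth_le)
  also have "\<dots> \<le> op_norm A * norm (axis j (1::complex))"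
    unfolding op_norm_def by (rule onorm[OF bl])
  finally show ?thesis by simp
qed

text \<open>
  The compression of the two shifts to the span of \<open>1\<close>, \<open>z\<^sub>1\<close> and \<open>4/5 z\<^sub>1\<^sup>2 + 3/5 z\<^sub>2\<close>, in this
  orthonormal basis, which is placed at the indices \<open>j0\<close>, \<open>j1\<close>, \<open>j2\<close>.
\<close>

definition jet_tuple :: "'d \<Rightarrow> 'd \<Rightarrow> 'n \<Rightarrow> 'n \<Rightarrow> 'n \<Rightarrow> 'd \<Rightarrow> complex ^ 'n ^ 'n::finite" where
  "jet_tuple i0 i1 j0 j1 j2 i =
     (if i = i0 then unit_mat j1 j0 1 + unit_mat j2 j1 (4/5)
      else if i = i1 then unit_mat j2 j0 (3/5) else 0)"

lemma commuting_jet_tuple: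
  assumes "j0 \<noteq> j1" "j0 \<noteq> j2" "j1 \<noteq> j2"
  shows "commuting (jet_tuple i0 i1 j0 j1 j2)"
  using assms
  by (auto simp: commuting_def jet_tuple_def unit_mat_mult matrix_add_ldistrib matrix_add_rdistrib)

text \<open>
  The entries \<open>4/5\<close> and \<open>3/5\<close> lie on the unit circle, so \<open>\<Sum> T\<^sub>i T\<^sub>i\<^sup>*\<close> is exactly the projection
  onto the last two basis vectors.
\<close>

lemma row_contraction_jet_tuple:
  fixes i0 :: "'d::finite"
  assumes "i0 \<noteq> i1" "j0 \<noteq> j1" "j0 \<noteq> j2" "j1 \<noteq> j2"
  shows "row_contraction (jet_tuple i0 i1 j0 j1 j2)"
proof -
  let ?T = "jet_tuple i0 i1 j0 j1 j2"
  let ?P = "unit_mat j1 j1 1 + unit_mat j2 j2 1"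
  have "(\<Sum>i\<in>UNIV. ?T i ** ctranspose (?T i)) = (\<Sum>i\<in>{i0,i1}. ?T i ** ctranspose (?T i))"
    by (rule sum.mono_neutral_right) (auto simp: jet_tuple_def ctranspose_zero)
  also have "\<dots> = unit_mat j1 j1 1 + (unit_mat j2 j2 (16/25) + unit_mat j2 j2 (9/25))"
    using assms
    by (simp add: jet_tuple_def ctranspose_add ctranspose_unit_mat unit_mat_mult
        matrix_add_ldistrib matrix_add_rdistrib add.assoc)
  also have "\<dots> = ?P"
    by (simp add: unit_mat_add)
  finally have s: "(\<Sum>i\<in>UNIV. ?T i ** ctranspose (?T i)) = ?P" .
  have "norm (?P *v x) \<le> norm x" for x
    by (rule norm_le_componentwise_cart)
       (use assms in \<open>auto simp: matrix_vector_mult_add_rdistrib unit_mat_mult_vec\<close>)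
  then have "op_norm ?P \<le> 1"
    unfolding op_norm_def by (intro onorm_bound) auto
  then show ?thesis
    unfolding row_contraction_def s by simp
qed

lemma mat_monom_single:
  fixes T :: "'d::finite \<Rightarrow> complex ^ 'n ^ 'n"
  shows "mat_monom (Poly_Mapping.single j n) T = matpow (T j) n"
proof -
  define f where "f = (\<lambda>i (M :: complex ^ 'n ^ 'n). if i = j then matpow (T j) n ** M else M)"
  have factor: "(\<lambda>i M. matpow (T i) (Poly_Mapping.lookup (Poly_Mapping.single j n) i) ** M) = f"
    by (auto simp: f_def fun_eq_iff lookup_single when_def matpow_def matrix_mul_lid)
  interpret comp_fun_commute f
    by unfold_locales (auto simp: f_def fun_eq_iff)
  have rest: "Finite_Set.fold f z A = z" if "finite A" "j \<notin> A" for z A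
    using that
  proof (induction A rule: finite_induct)
    case (insert i A)
    then have "Finite_Set.fold f z (insert i A) = f i z" by simp
    then show ?case using insert.prems by (auto simp: f_def)
  qed simp
  have "Finite_Set.fold f (mat 1) (insert j (UNIV - {j})) = f j (mat 1)"
    by (subst fold_insert) (auto simp: rest)
  moreover have "insert j (UNIV - {j}) = UNIV" by auto
  ultimately show ?thesis by (simp add: mat_monom_def factor f_def matrix_mul_rid)
qed

lemma eval_mat_witness_poly:
  "eval_mpoly_mat (witness_poly i0 i1) T = T i0 ** T i0 + T i1"
  unfolding eval_mpoly_mat_def
  by (subst sum_keys_witness_poly[where F = "\<lambda>m c. mat c ** mat_monom m T"])
     (simp add: mat_monom_single matpow_def matrix_mul_lid matrix_mul_rid numeral_2_eq_2)

lemma op_norm_witness_poly_jet_tuple: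
  assumes "i0 \<noteq> i1" "j0 \<noteq> j1" "j0 \<noteq> j2" "j1 \<noteq> j2"
  shows "op_norm (eval_mpoly_mat (witness_poly i0 i1) (jet_tuple i0 i1 j0 j1 j2)) \<ge> 7/5"
proof -
  have "eval_mpoly_mat (witness_poly i0 i1) (jet_tuple i0 i1 j0 j1 j2) = unit_mat j2 j0 (7/5)"
    using assms
    by (simp add: eval_mat_witness_poly jet_tuple_def unit_mat_mult unit_mat_add
        matrix_add_ldistrib matrix_add_rdistrib)
  then show ?thesis
    using entry_le_op_norm[of "unit_mat j2 j0 (7/5)" j2 j0] by (simp add: unit_mat_def)
qed

lemma best_const_greater_one:
  assumes "CARD('d::finite) \<ge> 2" "CARD('n::finite) \<ge> 3"
  shows "best_const TYPE('d) TYPE('n) > 1"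
proof -
  obtain i0 i1 :: 'd where i: "i0 \<noteq> i1"
    using ex_card[OF assms(1)] by (auto simp: card_2_iff)
  obtain j0 j1 j2 :: 'n where j: "j0 \<noteq> j1" "j0 \<noteq> j2" "j1 \<noteq> j2"
    using ex_card[OF assms(2)] by (auto simp: card_3_iff)
  let ?p = "witness_poly i0 i1" and ?T = "jet_tuple i0 i1 j0 j1 j2"
  have "ennreal (28/25) \<le> best_const TYPE('d) TYPE('n)"
    unfolding best_const_def
  proof (rule Inf_greatest)
    fix C assume "C \<in> {C. \<forall>(T :: 'd \<Rightarrow> complex ^ 'n ^ 'n) p.
     commuting T \<longrightarrow> row_contraction T \<longrightarrow>
     ennreal (op_norm (eval_mpoly_mat p T)) \<le> C * ennreal (sup_norm p)}"
    from this[unfolded mem_Collect_eq, rule_format, OF commuting_jet_tuple[OF j] row_contraction_jet_tuple[OF i j]]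
    have "ennreal (op_norm (eval_mpoly_mat ?p ?T)) \<le> C * ennreal (sup_norm ?p)" .
    moreover have "ennreal (7/5) \<le> ennreal (op_norm (eval_mpoly_mat ?p ?T))"
      by (rule ennreal_leI[OF op_norm_witness_poly_jet_tuple[OF i j]])
    moreover have "C * ennreal (sup_norm ?p) \<le> C * ennreal (5/4)"
      by (intro mult_left_mono ennreal_leI sup_norm_witness_poly_le[OF i]) simp
    ultimately have le: "ennreal (7/5) \<le> C * ennreal (5/4)" by (meson order_trans)
    show "ennreal (28/25) \<le> C"
    proof (cases C)
      case (real c)
      then have "ennreal (7/5) \<le> ennreal (c * (5/4))"
        using le by (simp only: ennreal_mult)
      then have "7/5 \<le> c * (5/4)"
        using real by (simp add: ennreal_le_iff del: ennreal_le_iff2)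
      then show ?thesis using real by (simp add: ennreal_leI)
    qed simp
  qed
  moreover have "1 < ennreal (28/25)"
    by (subst ennreal_1[symmetric], subst ennreal_less_iff) auto
  ultimately show ?thesis by (rule less_le_trans[rotated])
qed


section \<open>Reproducing kernel spaces on finite sets\<close>

text \<open>
  A weighted orthogonal system of coordinate functionals determines the space of all functions on
  a finite set. The expansion of point evaluations in these coordinates supplies everything that
  is not formal: a function with vanishing coordinates is zero, which is definiteness, and
  convergence of coordinates implies pointwise convergence, which is completeness.
\<close>

lemma rkhs_of_finite_coordinates:
  fixes X :: "'x set" and a :: "'j \<Rightarrow> 'x \<Rightarrow> complex" and L :: "'j \<Rightarrow> ('x \<Rightarrow> complex) \<Rightarrow> complex"
    and w :: "'j \<Rightarrow> real" and k :: "'x \<Rightarrow> 'x \<Rightarrow> complex"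
  defines "L \<equiv> \<lambda>j f. \<Sum>x\<in>X. a j x * f x"
  assumes fin: "finite X" "finite J"
    and w: "\<And>j. j \<in> J \<Longrightarrow> w j > 0"
    and rep: "\<And>f y. y \<in> X \<Longrightarrow> (\<Sum>j\<in>J. w j * L j f * cnj (L j (\<lambda>x. k x y))) = f y"
  shows "rkhs X k {f. \<forall>x. x \<notin> X \<longrightarrow> f x = 0} (\<lambda>f g. \<Sum>j\<in>J. w j * L j f * cnj (L j g))"
    (is "rkhs X k ?H ?ip")
proof -
  have L_add: "L j (\<lambda>x. f x + g x) = L j f + L j g" for j f g
    by (simp add: L_def distrib_left sum.distrib)
  have L_diff: "L j (\<lambda>x. f x - g x) = L j f - L j g" for j f g
    by (simp add: L_def right_diff_distrib sum_subtractf)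
  have L_scale: "L j (\<lambda>x. c * f x) = c * L j f" for j f c
    by (simp add: L_def sum_distrib_left mult_ac)
  have L_kernel: "L j (\<lambda>x. if x \<in> X then k x y else 0) = L j (\<lambda>x. k x y)" for j y
    by (simp add: L_def)
  have Re_ip: "Re (?ip f f) = (\<Sum>j\<in>J. w j * (cmod (L j f))^2)" for f
    by (simp add: mult.assoc complex_norm_square[symmetric])
  have coord_le: "cmod (L j f) \<le> ip_norm ?ip f / sqrt (w j)" if "j \<in> J" for j f
  proof -
    have "w j * (cmod (L j f))^2 \<le> (\<Sum>j\<in>J. w j * (cmod (L j f))^2)"
      using that fin w by (intro member_le_sum) (auto simp: less_imp_le)
    then have "sqrt (w j * (cmod (L j f))^2) \<le> ip_norm ?ip f"
      unfolding ip_norm_def Re_ip by (rule real_sqrt_le_mono)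
    then show ?thesis
      using w[OF that] by (simp add: real_sqrt_mult field_simps)
  qed
  show ?thesis
  proof (unfold_locales, goal_cases)
    case (7 f g)
    then show ?case by (simp add: mult_ac)
  next
    case (8 f)
    then have f0: "\<And>x. x \<notin> X \<Longrightarrow> f x = 0" by auto
    have "\<exists>j\<in>J. L j f \<noteq> 0"
    proof (rule ccontr)
      assume "\<not> (\<exists>j\<in>J. L j f \<noteq> 0)"
      then have "f y = 0" if "y \<in> X" for y
        using rep[OF that, of f] by simp
      then have "f = (\<lambda>x. 0)" using f0 by (intro ext) blast
      then show False using 8 by simp
    qed
    then obtain j where j: "j \<in> J" "L j f \<noteq> 0" by blast
    have "0 < (\<Sum>j\<in>J. w j * (cmod (L j f))^2)"
      by (rule sum_pos2[of J j]) (use fin j w in \<open>auto simp: less_imp_le\<close>)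
    then show ?case unfolding Re_ip .
  next
    case (9 s)
    have "\<exists>c. (\<lambda>n. L j (s n)) \<longlonglongrightarrow> c" if j: "j \<in> J" for j
    proof -
      have "Cauchy (\<lambda>n. L j (s n))"
      proof (rule metric_CauchyI)
        fix e :: real assume e: "e > 0"
        then obtain N where N: "\<forall>m\<ge>N. \<forall>n\<ge>N. ip_norm ?ip (\<lambda>x. s m x - s n x) < e * sqrt (w j)"
          using 9(2)[of "e * sqrt (w j)"] w[OF j] by auto
        have "dist (L j (s m)) (L j (s n)) < e" if "m \<ge> N" "n \<ge> N" for m n
        proof -
          have "dist (L j (s m)) (L j (s n)) \<le> ip_norm ?ip (\<lambda>x. s m x - s n x) / sqrt (w j)"
            using coord_le[OF j, of "\<lambda>x. s m x - s n x"] by (simp add: dist_norm L_diff)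
          also have "\<dots> < e" using N that w[OF j] by (simp add: pos_divide_less_eq)
          finally show ?thesis .
        qed
        then show "\<exists>M. \<forall>m\<ge>M. \<forall>n\<ge>M. dist (L j (s m)) (L j (s n)) < e" by blast
      qed
      then show ?thesis using Cauchy_convergent convergent_def by blast
    qed
    then obtain c where c: "\<And>j. j \<in> J \<Longrightarrow> (\<lambda>n. L j (s n)) \<longlonglongrightarrow> c j" by metis
    define f where "f = (\<lambda>y. if y \<in> X then \<Sum>j\<in>J. w j * c j * cnj (L j (\<lambda>x. k x y)) else 0)"
    have s_lim: "(\<lambda>n. s n y) \<longlonglongrightarrow> f y" if y: "y \<in> X" for y
    proof -
      have "(\<lambda>n. \<Sum>j\<in>J. w j * L j (s n) * cnj (L j (\<lambda>x. k x y))) \<longlonglongrightarrow> f y"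
        using y by (simp add: f_def) (intro tendsto_intros c)
      then show ?thesis using rep[OF y] by simp
    qed
    have L_lim: "(\<lambda>n. L j (\<lambda>x. s n x - f x)) \<longlonglongrightarrow> 0" for j
    proof -
      have "(\<lambda>n. \<Sum>x\<in>X. a j x * (s n x - f x)) \<longlonglongrightarrow> (\<Sum>x\<in>X. a j x * (f x - f x))"
        by (intro tendsto_intros s_lim)
      then show ?thesis by (simp add: L_def)
    qed
    have "(\<lambda>n. sqrt (\<Sum>j\<in>J. w j * (cmod (L j (\<lambda>x. s n x - f x)))^2))
        \<longlonglongrightarrow> sqrt (\<Sum>j\<in>J. w j * (cmod 0)^2)"
      by (intro tendsto_intros L_lim)
    then have "(\<lambda>n. ip_norm ?ip (\<lambda>x. s n x - f x)) \<longlonglongrightarrow> 0"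
      unfolding ip_norm_def Re_ip by simp
    moreover have "f \<in> ?H" by (simp add: f_def)
    ultimately show ?case by blast
  next
    case (11 f y)
    then show ?case using rep[of y f] by (simp only: L_kernel)
  qed (auto simp: L_add L_scale distrib_left distrib_right sum.distrib sum_distrib_left mult_ac)
qed

text \<open>
  A bound that holds in every space with kernel \<open>k\<close> holds in the chosen one. Existence is essential:
  otherwise the choice could return a pair without any relation to \<open>k\<close>.
\<close>

lemma rkhs_mult_norm_greaterI:
  assumes "\<exists>H ip. rkhs X k H ip"
    and "\<And>H ip. rkhs X k H ip \<Longrightarrow> c < mult_op_norm H ip g"
  shows "c < rkhs_mult_norm X k g"
proof -
  have "\<exists>q. case q of (H, ip) \<Rightarrow> rkhs X k H ip"
    using assms(1) by simp
  then have "case (SOME q. case q of (H, ip) \<Rightarrow> rkhs X k H ip) of (H, ip) \<Rightarrow> rkhs X k H ip"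
    by (rule someI_ex)
  then show ?thesis
    unfolding rkhs_mult_norm_def by (rule case_prodE) (simp add: assms(2))
qed


section \<open>Three points on a parabola\<close>

definition pt0 :: "complex ^ 2" where "pt0 = 0"
definition pt1 :: "complex ^ 2" where "pt1 = vector [1/2, 1/4]"
definition pt2 :: "complex ^ 2" where "pt2 = vector [-1/2, 1/4]"

lemma pts_distinct: "pt0 \<noteq> pt1" "pt0 \<noteq> pt2" "pt1 \<noteq> pt2" "pt1 \<noteq> pt0" "pt2 \<noteq> pt0" "pt2 \<noteq> pt1"
  by (auto simp: pt0_def pt1_def pt2_def vec_eq_iff forall_2)

lemma pts_in_ball: "{pt0, pt1, pt2} \<subseteq> ball 0 1"
  by (simp add: pt0_def pt1_def pt2_def norm_vec_def L2_set_def sum_2 norm_divide power2_eq_square)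

lemma da_kernel_pts:
  "da_kernel pt0 z = 1" "da_kernel z pt0 = 1"
  "da_kernel pt1 pt1 = 16/11" "da_kernel pt2 pt2 = 16/11"
  "da_kernel pt1 pt2 = 16/19" "da_kernel pt2 pt1 = 16/19"
  by (simp_all add: da_kernel_def pt0_def pt1_def pt2_def sum_2)

text \<open>
  The kernel at the origin is the constant \<open>1\<close>. Removing its rank one contribution from the
  kernel matrix leaves a \<open>2 \<times> 2\<close> matrix with diagonal entries \<open>16/11 - 1 = 5/11\<close> and off-diagonal
  entries \<open>16/19 - 1 = -3/19\<close>. Its eigenvectors \<open>(1, 1)\<close> and \<open>(1, -1)\<close> have eigenvalues \<open>62/209\<close> and
  \<open>128/209\<close>. This gives the coordinates \<open>f(0)\<close>, \<open>f(x) + f(y) - 2 f(0)\<close>, \<open>f(x) - f(y)\<close> for the outer points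
  \<open>x, y\<close>, and the last two have half the inverse eigenvalues as weights.
\<close>

lemma rkhs_three_points_exists: "\<exists>H ip. rkhs {pt0, pt1, pt2} da_kernel H ip"
proof -
  define a :: "nat \<Rightarrow> complex ^ 2 \<Rightarrow> complex" where
    "a = (\<lambda>j x. if j = 0 then (if x = pt0 then 1 else 0)
                else if j = 1 then (if x = pt0 then -2 else 1)
                else (if x = pt0 then 0 else if x = pt1 then 1 else -1))"
  define w :: "nat \<Rightarrow> real" where
    "w = (\<lambda>j. if j = 0 then 1 else if j = 1 then 209/124 else 209/256)"
  have "rkhs {pt0, pt1, pt2} da_kernel {f. \<forall>x. x \<notin> {pt0, pt1, pt2} \<longrightarrow> f x = 0}
    (\<lambda>f g. \<Sum>j\<in>{0,1,2}. w j * (\<Sum>x\<in>{pt0, pt1, pt2}. a j x * f x)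
        * cnj (\<Sum>x\<in>{pt0, pt1, pt2}. a j x * g x))"
  proof (rule rkhs_of_finite_coordinates)
    show "(\<Sum>j\<in>{0,1,2}. w j * (\<Sum>x\<in>{pt0, pt1, pt2}. a j x * f x)
        * cnj (\<Sum>x\<in>{pt0, pt1, pt2}. a j x * da_kernel x y)) = f y"
      if "y \<in> {pt0, pt1, pt2}" for f y
      using that
      by (auto simp: a_def w_def pts_distinct da_kernel_pts field_simps)
  qed (auto simp: w_def)
  then show ?thesis by blast
qed

text \<open>
  The test function is a multiple of the sum \<open>k\<^sub>1 + k\<^sub>2\<close> of the kernel functions at the outer points.
  Its product with \<open>p\<close> vanishes at the origin and equals \<open>240/209\<close> at the outer points; so it is
  \<open>120/31\<close> times \<open>k\<^sub>1 + k\<^sub>2 - 2 k\<^sub>0\<close>, and the reproducing property gives both norms in any space with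
  this kernel. The factor \<open>9/20\<close> is a rational number slightly below the inverse of the norm of
  \<open>k\<^sub>1 + k\<^sub>2\<close>.
\<close>

lemma mult_op_norm_three_points:
  assumes "rkhs {pt0, pt1, pt2} da_kernel H ip"
  shows "mult_op_norm H ip (eval_mpoly (witness_poly 1 2)) > ennreal (5/4)"
proof -
  interpret rkhs "{pt0, pt1, pt2}" da_kernel H ip by fact
  let ?X = "{pt0, pt1, pt2}" and ?g = "eval_mpoly (witness_poly (1::2) 2)"
  define k0 where "k0 = (\<lambda>x. if x \<in> ?X then da_kernel x pt0 else 0)"
  define k1 where "k1 = (\<lambda>x. if x \<in> ?X then da_kernel x pt1 else 0)"
  define k2 where "k2 = (\<lambda>x. if x \<in> ?X then da_kernel x pt2 else 0)"
  define comb where "comb = (\<lambda>c0 c x. c0 * k0 x + c * (k1 x + k2 x))"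
  have k_mem: "k0 \<in> H" "k1 \<in> H" "k2 \<in> H"
    unfolding k0_def k1_def k2_def by (rule kernel_mem; simp)+
  have ip_k: "ip f k0 = f pt0" "ip f k1 = f pt1" "ip f k2 = f pt2" if "f \<in> H" for f
    unfolding k0_def k1_def k2_def by (rule reproducing[OF that]; simp)+
  have comb_mem: "comb c0 c \<in> H" for c0 c
    unfolding comb_def by (intro add_mem scale_mem k_mem)
  have comb_vals: "comb c0 c pt0 = c0 + 2 * c" "comb c0 c pt1 = c0 + c * (480/209)"
    "comb c0 c pt2 = c0 + c * (480/209)" for c0 c
    by (simp_all add: comb_def k0_def k1_def k2_def da_kernel_pts)
  have comb_ip: "ip (comb c0 c) f = c0 * cnj (f pt0) + c * (cnj (f pt1) + cnj (f pt2))"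
    if "f \<in> H" for c0 c f
  proof -
    have "ip (comb c0 c) f = c0 * ip k0 f + c * (ip k1 f + ip k2 f)"
      unfolding comb_def by (simp add: ip_add ip_scale add_mem scale_mem k_mem that)
    moreover have "ip k0 f = cnj (f pt0)" "ip k1 f = cnj (f pt1)" "ip k2 f = cnj (f pt2)"
      using ip_cnj[OF that] ip_k[OF that] k_mem by metis+
    ultimately show ?thesis by simp
  qed
  have comb_norm: "ip_norm ip (comb (of_real c0) (of_real c))
      = sqrt (c0 * (c0 + 2 * c) + 2 * c * (c0 + c * (480/209)))" for c0 c
    by (simp add: ip_norm_def comb_ip comb_mem comb_vals)
  have g_vals: "?g pt0 = 0" "?g pt1 = 1/2" "?g pt2 = 1/2"
    by (simp_all add: eval_witness_poly pt0_def pt1_def pt2_def power2_eq_square)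
  let ?f = "comb (of_real 0) (of_real (9/20))"
  let ?h = "comb (of_real (-108/31)) (of_real (54/31))"
  have mult: "(\<lambda>x. ?g x * ?f x) = ?h"
  proof
    fix x
    show "?g x * ?f x = ?h x"
    proof (cases "x \<in> ?X")
      case True
      then show ?thesis
        by (auto simp: g_vals comb_vals)
    next
      case False
      then show ?thesis using vanish[OF comb_mem] by simp
    qed
  qed
  have f_norm: "ip_norm ip ?f \<le> 1"
    unfolding comb_norm by simp
  have h_norm: "ip_norm ip ?h > 5/4"
    unfolding comb_norm by (rule real_less_rsqrt) (simp add: power2_eq_square)
  show ?thesis
  proof (cases "\<forall>f\<in>H. (\<lambda>x. ?g x * f x) \<in> H")
    case True
    have "ennreal (5/4) < ennreal (ip_norm ip (\<lambda>x. ?g x * ?f x))"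
      unfolding mult using h_norm by (subst ennreal_less_iff) auto
    also have "\<dots> \<le> (SUP f\<in>{f\<in>H. ip_norm ip f \<le> 1}. ennreal (ip_norm ip (\<lambda>x. ?g x * f x)))"
      by (rule SUP_upper) (use comb_mem f_norm in blast)
    finally show ?thesis using True by (simp add: mult_op_norm_def)
  next
    case False
    then show ?thesis by (auto simp: mult_op_norm_def)
  qed
qed


section \<open>The strict inequalities\<close>

theorem proposition3p5:
  shows "(\<exists>p :: 2 mpoly.
            npoint_mult_norm 3 (eval_mpoly p) > ennreal (sup_norm p) \<and>
            (\<exists>T :: 2 \<Rightarrow> complex ^ 3 ^ 3.
               commuting T \<and> row_contraction T \<and> op_norm (eval_mpoly_mat p T) > sup_norm p))
       \<and> (CARD('d::finite) \<ge> 2 \<longrightarrow> CARD('n::finite) \<ge> 3 \<longrightarrow>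
            best_const TYPE('d) TYPE('n) > 1)"
proof (intro conjI impI exI)
  let ?p = "witness_poly (1::2) 2" and ?T = "jet_tuple (1::2) 2 (1::3) 2 3"
  have i: "(1::2) \<noteq> 2" by simp
  have j: "(1::3) \<noteq> 2" "(1::3) \<noteq> 3" "(2::3) \<noteq> 3" by simp_all
  have "ennreal (sup_norm ?p) \<le> ennreal (5/4)"
    by (rule ennreal_leI[OF sup_norm_witness_poly_le[OF i]])
  also have "\<dots> < rkhs_mult_norm {pt0, pt1, pt2} da_kernel (eval_mpoly ?p)"
    by (rule rkhs_mult_norm_greaterI[OF rkhs_three_points_exists mult_op_norm_three_points])
  also have "\<dots> \<le> npoint_mult_norm 3 (eval_mpoly ?p)"
    unfolding npoint_mult_norm_def
    by (rule SUP_upper) (use pts_in_ball in \<open>simp add: pts_distinct\<close>)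
  finally show "npoint_mult_norm 3 (eval_mpoly ?p) > ennreal (sup_norm ?p)" .
  show "commuting ?T" by (rule commuting_jet_tuple[OF j])
  show "row_contraction ?T" by (rule row_contraction_jet_tuple[OF i j])
  show "op_norm (eval_mpoly_mat ?p ?T) > sup_norm ?p"
    using op_norm_witness_poly_jet_tuple[OF i j] sup_norm_witness_poly_le[OF i] by simp
next
  assume "CARD('d) \<ge> 2" "CARD('n) \<ge> 3"
  then show "best_const TYPE('d) TYPE('n) > 1" by (rule best_const_greater_one)
qed

end
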